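(* Let $\mathcal{S}$ be a balanced system of $\mathbb{Z}$-equations and assume some equation of $\mathcal{S}$ is dominant, with dominant coefficient $b\geq2$. Then for every prime $p>b$ there exists $n_0=n_0(p)$ such that for every $n\geq n_0$, \[ \mathrm{ex}^{\sharp}_{\mathcal{S}}(n,p)\geq \left(\frac{p}{b}\right)^n . \]
   Context: A $\mathbb{Z}$-equation $\sum_{i=1}^r b_ix_i=0$ is balanced if $\sum_i b_i=0$; a system is balanced if all equations are. A balanced equation is dominant if there is $j$ with $b_j>0$ and $b_i\leq0$ for all $i\neq j$, or $b_j<0$ and $b_i\geq0$ for all $i\neq j$; its dominant coefficient is $|b_j|$. For a prime $p$, $\mathcal{S}(p)$ is the mod $p$ reduction of $\mathcal{S}$. $A\subseteq\mathbb{F}_p^n$ is weakly $\mathcal{S}(p)$-free if there is no solution $(x_1,\dots,x_r)\in A^r$ of $\mathcal{S}(p)$ with pairwise distinct $x_1,\dots,x_r$; $\mathrm{ex}^{\sharp}_{\mathcal{S}}(n,p)$ is the maximum size of such $A$. *)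

theory Defs
  imports Complex_Main "HOL-Number_Theory.Residues"
begin

text \<open>
  The variables are indexed by a finite type \<open>'r\<close>; a \<open>\<int>\<close>-equation \<open>\<Sum>i. e i * x i = 0\<close> is
  represented by its coefficient function \<open>e\<close>, and a system is a finite list of equations
  in the same variables.
\<close>

type_synonym 'r equation = "'r \<Rightarrow> int"
type_synonym 'r eqsystem = "'r equation list"

definition balanced_eq :: "('r::finite) equation \<Rightarrow> bool" where
  "balanced_eq e \<longleftrightarrow> (\<Sum>i\<in>UNIV. e i) = 0"

definition balanced :: "('r::finite) eqsystem \<Rightarrow> bool" where
  "balanced S \<longleftrightarrow> (\<forall>e\<in>set S. balanced_eq e)"

definition dominant_at :: "('r::finite) equation \<Rightarrow> 'r \<Rightarrow> bool" where
  "dominant_at e j \<longleftrightarrow>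
     (e j > 0 \<and> (\<forall>i. i \<noteq> j \<longrightarrow> e i \<le> 0)) \<or> (e j < 0 \<and> (\<forall>i. i \<noteq> j \<longrightarrow> e i \<ge> 0))"

definition dominant_with_coeff :: "('r::finite) equation \<Rightarrow> int \<Rightarrow> bool" where
  "dominant_with_coeff e b \<longleftrightarrow> balanced_eq e \<and> (\<exists>j. dominant_at e j \<and> b = \<bar>e j\<bar>)"

text \<open>An index \<open>j\<close> witnessing dominance need not be unique, but the dominant coefficient is.\<close>

lemma dominant_coeff_unique:
  assumes "dominant_with_coeff e b" "dominant_with_coeff e c"
  shows "b = c"
proof -
  have half: "2 * \<bar>e j\<bar> = (\<Sum>i\<in>UNIV. \<bar>e i\<bar>)" if bal: "balanced_eq e" and dom: "dominant_at e j" for j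
  proof -
    have s: "e j + (\<Sum>i\<in>UNIV-{j}. e i) = 0"
      using bal unfolding balanced_eq_def by (simp add: sum.remove[of UNIV j])
    have a: "(\<Sum>i\<in>UNIV. \<bar>e i\<bar>) = \<bar>e j\<bar> + (\<Sum>i\<in>UNIV-{j}. \<bar>e i\<bar>)"
      by (simp add: sum.remove[of UNIV j])
    from dom consider "e j > 0" "\<forall>i. i \<noteq> j \<longrightarrow> e i \<le> 0" | "e j < 0" "\<forall>i. i \<noteq> j \<longrightarrow> e i \<ge> 0"
      unfolding dominant_at_def by blast
    then show ?thesis
    proof cases
      case 1
      then have "(\<Sum>i\<in>UNIV-{j}. \<bar>e i\<bar>) = (\<Sum>i\<in>UNIV-{j}. - e i)" by (intro sum.cong) auto
      with 1 s a show ?thesis by (simp add: sum_negf)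
    next
      case 2
      then have "(\<Sum>i\<in>UNIV-{j}. \<bar>e i\<bar>) = (\<Sum>i\<in>UNIV-{j}. e i)" by (intro sum.cong) auto
      with 2 s a show ?thesis by simp
    qed
  qed
  obtain j where "dominant_at e j" "b = \<bar>e j\<bar>" "balanced_eq e"
    using assms(1) unfolding dominant_with_coeff_def by blast
  moreover obtain k where "dominant_at e k" "c = \<bar>e k\<bar>"
    using assms(2) unfolding dominant_with_coeff_def by blast
  ultimately have "2 * b = 2 * c" using half[of j] half[of k] by simp
  then show ?thesis by simp
qed

text \<open>
  For prime \<open>p\<close>, \<open>F\<^sub>p\<close> is the library's residue ring with carrier \<open>{0..p - 1}\<close>. Vectors in \<open>F\<^sub>p\<^sup>n\<close>
  are extensional functions on \<open>{..<n}\<close>, so that there are exactly \<open>p ^ n\<close> of them.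
\<close>

definition Fp :: "nat \<Rightarrow> int ring" where
  "Fp p = residue_ring (int p)"

definition Fp_space :: "nat \<Rightarrow> nat \<Rightarrow> (nat \<Rightarrow> int) set" where
  "Fp_space p n = {..<n} \<rightarrow>\<^sub>E carrier (Fp p)"

definition reduce_mod :: "nat \<Rightarrow> 'r eqsystem \<Rightarrow> 'r eqsystem" where
  "reduce_mod p S = map (\<lambda>e i. e i mod int p) S"

text \<open>
  \<open>x i\<close> is the vector assigned to the variable \<open>i\<close>; an equation between vectors is read
  coordinatewise. The coefficients of \<open>E\<close> are meant to lie in the carrier of \<open>Fp p\<close>.
\<close>

definition is_solution :: "nat \<Rightarrow> nat \<Rightarrow> ('r::finite) eqsystem \<Rightarrow> ('r \<Rightarrow> nat \<Rightarrow> int) \<Rightarrow> bool" where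
  "is_solution p n E x \<longleftrightarrow>
     (\<forall>e\<in>set E. \<forall>k<n. (\<Oplus>\<^bsub>Fp p\<^esub>i\<in>UNIV. e i \<otimes>\<^bsub>Fp p\<^esub> x i k) = \<zero>\<^bsub>Fp p\<^esub>)"

definition weakly_free :: "('r::finite) eqsystem \<Rightarrow> nat \<Rightarrow> nat \<Rightarrow> (nat \<Rightarrow> int) set \<Rightarrow> bool" where
  "weakly_free S p n A \<longleftrightarrow>
     \<not> (\<exists>x :: 'r \<Rightarrow> nat \<Rightarrow> int. (\<forall>i. x i \<in> A) \<and> inj x \<and> is_solution p n (reduce_mod p S) x)"

definition ex_sharp :: "('r::finite) eqsystem \<Rightarrow> nat \<Rightarrow> nat \<Rightarrow> nat" where
  "ex_sharp S n p = Max (card ` {A. A \<subseteq> Fp_space p n \<and> weakly_free S p n A})"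

text \<open>The maximum is over a nonempty finite family, so \<open>Max\<close> is meaningful.\<close>

lemma ex_sharp_family:
  fixes S :: "('r::finite) eqsystem"
  assumes "p > 0"
  shows "finite {A. A \<subseteq> Fp_space p n \<and> weakly_free S p n A}"
    and "{} \<in> {A. A \<subseteq> Fp_space p n \<and> weakly_free S p n A}"
proof -
  have "finite (Fp_space p n)"
    unfolding Fp_space_def Fp_def residue_ring_def by (intro finite_PiE) auto
  then show "finite {A. A \<subseteq> Fp_space p n \<and> weakly_free S p n A}"
    by (rule_tac finite_subset[of _ "Pow (Fp_space p n)"]) auto
  show "{} \<in> {A. A \<subseteq> Fp_space p n \<and> weakly_free S p n A}"
    by (simp add: weakly_free_def)
qed

end

theory Submission
  imports Defs "HOL-Real_Asymp.Real_Asymp"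
begin

text \<open>
  As in Behrend's construction, take the vectors with coordinates in \<open>{0..m}\<close>, \<open>m = \<lfloor>(p - 1) / b\<rfloor>\<close>,
  lying on a sphere. Since \<open>b * m < p\<close>, the dominant equation cannot wrap around modulo \<open>p\<close>, so it
  expresses one point of the sphere as a convex combination of others; strict convexity then forces
  two of the variables to coincide. A most popular sphere contains at least
  \<open>(m + 1) ^ n / (n * m\<^sup>2 + 1)\<close> vectors, and \<open>m + 1 > p / b\<close> because \<open>b\<close> does not divide \<open>p\<close>.
\<close>

lemma finsum_residue_ring:
  assumes "residues m" "finite I"
  shows "(\<Oplus>\<^bsub>residue_ring m\<^esub>i\<in>I. f i mod m) = (\<Sum>i\<in>I. f i) mod m"
  using assms(2)
proof (induction I rule: finite_induct)
  case empty
  interpret residues m "residue_ring m" by (rule assms(1))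
  show ?case by (simp add: res_zero_eq)
next
  case (insert i I)
  interpret residues m "residue_ring m" by (rule assms(1))
  have "(\<Oplus>\<^bsub>residue_ring m\<^esub>i\<in>insert i I. f i mod m)
      = f i mod m \<oplus>\<^bsub>residue_ring m\<^esub> (\<Oplus>\<^bsub>residue_ring m\<^esub>i\<in>I. f i mod m)"
    using insert by (intro finsum_insert) auto
  then show ?case
    using insert by (simp add: res_add_eq mod_simps)
qed

text \<open>Replaces ring arithmetic on reduced coefficients by divisibility of integer sums with
  the original coefficients, where sizes and signs can be compared.\<close>

lemma is_solution_reduce_mod_iff:
  fixes S :: "('r::finite) eqsystem"
  assumes "1 < p"
  shows "is_solution p n (reduce_mod p S) x \<longleftrightarrow>
    (\<forall>e\<in>set S. \<forall>k<n. int p dvd (\<Sum>i\<in>UNIV. e i * x i k))"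
proof -
  have mod_sum: "(\<Sum>i\<in>UNIV. e i mod int p * x i k) mod int p = (\<Sum>i\<in>UNIV. e i * x i k) mod int p"
    for e :: "'r equation" and k
    by (fold unique_euclidean_semiring_class.cong_def, intro cong_sum)
      (simp add: unique_euclidean_semiring_class.cong_def mod_simps)
  have res: "residues (int p)"
    using assms by (simp add: residues_def)
  interpret residues "int p" "residue_ring (int p)" by (rule res)
  show ?thesis
    by (simp add: mod_sum is_solution_def reduce_mod_def Fp_def res_mult_eq res_zero_eq mod_simps
        finsum_residue_ring[OF res] dvd_eq_mod_eq_0)
qed

text \<open>
  Balance and the equation make the \<open>e\<close>-weighted sum of the squared distances to \<open>x j\<close> vanish,
  while dominance gives all its terms the same sign.
\<close>
lemma dominant_on_sphere_coincide:
  fixes e :: "('r::finite) equation" and x :: "'r \<Rightarrow> nat \<Rightarrow> int"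
  assumes bal: "balanced_eq e" and dom: "dominant_at e j"
    and eq: "\<And>k. k \<in> K \<Longrightarrow> (\<Sum>i\<in>UNIV. e i * x i k) = 0"
    and sphere: "\<And>i. (\<Sum>k\<in>K. (x i k)\<^sup>2) = r"
    and "e i \<noteq> 0" "k \<in> K" "finite K"
  shows "x i k = x j k"
proof (cases "i = j")
  case False
  define d where "d i = (\<Sum>k\<in>K. (x i k - x j k)\<^sup>2)" for i
  have d_nonneg: "d i \<ge> 0" for i
    unfolding d_def by (intro sum_nonneg) auto
  \<comment> \<open>This is the inner product of the vector equation with \<open>x j\<close>; after
    swapping the sums, each coordinate contributes a multiple of zero.\<close>
  have cross: "(\<Sum>i\<in>UNIV. e i * (\<Sum>k\<in>K. x i k * x j k)) = 0"
  proof -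
    have "(\<Sum>i\<in>UNIV. e i * (\<Sum>k\<in>K. x i k * x j k)) = (\<Sum>k\<in>K. x j k * (\<Sum>i\<in>UNIV. e i * x i k))"
      unfolding sum_distrib_left by (subst sum.swap) (simp add: mult_ac)
    with eq show ?thesis by simp
  qed
  \<comment> \<open>Both points have squared norm \<open>r\<close>, so the distance depends on
    \<open>i\<close> only through the inner product.\<close>
  have d_eq: "d i = 2 * r - 2 * (\<Sum>k\<in>K. x i k * x j k)" for i
  proof -
    have "d i = (\<Sum>k\<in>K. (x i k)\<^sup>2 + (x j k)\<^sup>2 - 2 * (x i k * x j k))"
      unfolding d_def by (intro sum.cong) (auto simp: power2_eq_square algebra_simps)
    then show ?thesis
      by (simp add: sum.distrib sum_subtractf sphere sum_distrib_left)
  qed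
  have "(\<Sum>i\<in>UNIV. e i * d i)
      = (\<Sum>i\<in>UNIV. e i) * (2 * r) - 2 * (\<Sum>i\<in>UNIV. e i * (\<Sum>k\<in>K. x i k * x j k))"
    by (simp add: d_eq right_diff_distrib sum_subtractf sum_distrib_left sum_distrib_right
        mult.left_commute)
  then have total: "(\<Sum>i\<in>UNIV. e i * d i) = 0"
    using bal cross by (simp add: balanced_eq_def)
  \<comment> \<open>The coefficient at \<open>j\<close> is the one of the opposite sign; this makes
    its term vanish, so the remaining terms cannot cancel.\<close>
  have "d j = 0" by (simp add: d_def)
  have "e i * d i = 0"
    using dom unfolding dominant_at_def
  proof
    assume "e j > 0 \<and> (\<forall>i. i \<noteq> j \<longrightarrow> e i \<le> 0)"
    then have "0 \<le> - (e i * d i)" for i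
      using d_nonneg[of i] \<open>d j = 0\<close> by (cases "i = j") (auto simp: mult_le_0_iff)
    moreover have "(\<Sum>i\<in>UNIV. - (e i * d i)) = 0"
      using total by (simp add: sum_negf)
    ultimately show ?thesis
      using sum_nonneg_eq_0_iff[of UNIV "\<lambda>i. - (e i * d i)"] by auto
  next
    assume "e j < 0 \<and> (\<forall>i. i \<noteq> j \<longrightarrow> e i \<ge> 0)"
    then have "0 \<le> e i * d i" for i
      using d_nonneg[of i] \<open>d j = 0\<close> by (cases "i = j") auto
    then show ?thesis
      using total sum_nonneg_eq_0_iff[of UNIV "\<lambda>i. e i * d i"] by auto
  qed
  then have "d i = 0" using \<open>e i \<noteq> 0\<close> by simp
  then show ?thesis
    using \<open>k \<in> K\<close> \<open>finite K\<close> unfolding d_def by (subst (asm) sum_nonneg_eq_0_iff) auto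
qed simp

text \<open>The term at \<open>j\<close> and the sum of the other terms have opposite signs, and by
  balance each is at most \<open>\<bar>e j\<bar> * m\<close> in absolute value. Hence so is the
  whole sum, and the only multiple of \<open>p\<close> in that range is 0.\<close>

lemma dominant_eq_no_wraparound:
  fixes e :: "('r::finite) equation" and x :: "'r \<Rightarrow> int"
  assumes bal: "balanced_eq e" and dom: "dominant_at e j"
    and x: "\<And>i. 0 \<le> x i" "\<And>i. x i \<le> m" and small: "\<bar>e j\<bar> * m < p"
    and dvd: "p dvd (\<Sum>i\<in>UNIV. e i * x i)"
  shows "(\<Sum>i\<in>UNIV. e i * x i) = 0"
proof -
  let ?R = "\<Sum>i\<in>UNIV-{j}. e i * x i"
  have split: "(\<Sum>i\<in>UNIV. e i * x i) = e j * x j + ?R"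
    by (simp add: sum.remove[of UNIV j])
  have rest: "(\<Sum>i\<in>UNIV-{j}. e i * m) = - e j * m"
  proof -
    have "e j + (\<Sum>i\<in>UNIV-{j}. e i) = 0"
      using bal unfolding balanced_eq_def by (simp add: sum.remove[of UNIV j])
    then have "(\<Sum>i\<in>UNIV-{j}. e i) = - e j" by simp
    then show ?thesis by (simp add: sum_distrib_right[symmetric])
  qed
  have "\<bar>\<Sum>i\<in>UNIV. e i * x i\<bar> \<le> \<bar>e j\<bar> * m"
    using dom unfolding dominant_at_def
  proof
    assume a: "e j > 0 \<and> (\<forall>i. i \<noteq> j \<longrightarrow> e i \<le> 0)"
    have "?R \<ge> (\<Sum>i\<in>UNIV-{j}. e i * m)"
      using a x by (intro sum_mono mult_left_mono_neg) auto
    moreover have "?R \<le> 0"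
      using a x by (intro sum_nonpos) (auto simp: mult_le_0_iff)
    moreover have "0 \<le> e j * x j" "e j * x j \<le> e j * m"
      using a x by (auto intro: mult_left_mono)
    moreover have "\<bar>e j\<bar> * m = e j * m" using a by simp
    ultimately show ?thesis unfolding split using rest by linarith
  next
    assume a: "e j < 0 \<and> (\<forall>i. i \<noteq> j \<longrightarrow> e i \<ge> 0)"
    have "?R \<le> (\<Sum>i\<in>UNIV-{j}. e i * m)"
      using a x by (intro sum_mono mult_left_mono) auto
    moreover have "?R \<ge> 0"
      using a x by (intro sum_nonneg) auto
    moreover have "e j * x j \<le> 0" "e j * m \<le> e j * x j"
      using a x by (auto intro: mult_left_mono_neg simp: mult_le_0_iff)
    moreover have "\<bar>e j\<bar> * m = - (e j * m)" using a by simp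
    ultimately show ?thesis unfolding split using rest by linarith
  qed
  with small have "\<bar>\<Sum>i\<in>UNIV. e i * x i\<bar> < \<bar>p\<bar>" by linarith
  with dvd show ?thesis by (meson dvd_imp_le_int leD)
qed

text \<open>Pigeonhole: squared norms on the cube are integers from 0 to
  \<open>n * m\<^sup>2\<close>, so \<open>n * m\<^sup>2 + 1\<close> spheres cover all
  \<open>(m + 1) ^ n\<close> points. The product form avoids division of naturals.\<close>

lemma card_popular_sphere:
  fixes m n :: nat
  obtains r :: int where
    "(m + 1) ^ n \<le> (n * m\<^sup>2 + 1) * card {v \<in> {..<n} \<rightarrow>\<^sub>E {0..int m}. (\<Sum>k<n. (v k)\<^sup>2) = r}"
proof -
  let ?C = "{..<n} \<rightarrow>\<^sub>E {0..int m}"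
  let ?R = "{0..int (n * m\<^sup>2)}"
  let ?A = "\<lambda>r. {v \<in> ?C. (\<Sum>k<n. (v k)\<^sup>2) = r}"
  have "(\<Sum>k<n. (v k)\<^sup>2) \<in> ?R" if "v \<in> ?C" for v
  proof -
    have "(v k)\<^sup>2 \<le> (int m)\<^sup>2" if "k < n" for k
      using PiE_mem[OF \<open>v \<in> ?C\<close>, of k] that by (intro power_mono) auto
    then have "(\<Sum>k<n. (v k)\<^sup>2) \<le> (\<Sum>k<n. (int m)\<^sup>2)"
      by (intro sum_mono) auto
    then show ?thesis by (auto intro: sum_nonneg)
  qed
  then have "?C = (\<Union>r\<in>?R. ?A r)" by auto
  then have "card ?C \<le> (\<Sum>r\<in>?R. card (?A r))"
    using card_UN_le[of ?R ?A] by simp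
  moreover have "\<exists>r. (m + 1) ^ n \<le> (n * m\<^sup>2 + 1) * card (?A r)"
  proof (rule ccontr)
    assume *: "\<not> ?thesis"
    have "(n * m\<^sup>2 + 1) * (\<Sum>r\<in>?R. card (?A r)) = (\<Sum>r\<in>?R. (n * m\<^sup>2 + 1) * card (?A r))"
      by (rule sum_distrib_left)
    also have "\<dots> < (\<Sum>r\<in>?R. (m + 1) ^ n)"
      using * by (intro sum_strict_mono) (auto simp: not_le)
    also have "\<dots> = (n * m\<^sup>2 + 1) * (m + 1) ^ n"
      by (simp add: nat_add_distrib nat_mult_distrib nat_power_eq)
    finally have "(\<Sum>r\<in>?R. card (?A r)) < (m + 1) ^ n"
      using mult_less_cancel1 by blast
    moreover have "card ?C = (m + 1) ^ n"
      by (simp add: card_PiE nat_add_distrib)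
    ultimately show False
      using \<open>card ?C \<le> (\<Sum>r\<in>?R. card (?A r))\<close> by linarith
  qed
  ultimately show ?thesis using that by blast
qed

text \<open>A solution in the sphere satisfies the dominant equation over the integers, so every
  variable with nonzero coefficient takes the same value as \<open>x j\<close>, against
  injectivity.\<close>

lemma sphere_weakly_free:
  fixes S :: "('r::finite) eqsystem"
  assumes "e \<in> set S" "dominant_with_coeff e b" "1 < p" "b * int m < int p"
  shows "weakly_free S p n {v \<in> {..<n} \<rightarrow>\<^sub>E {0..int m}. (\<Sum>k<n. (v k)\<^sup>2) = r}"
    (is "weakly_free S p n ?A")
proof -
  obtain j where bal: "balanced_eq e" and dom: "dominant_at e j" and b: "b = \<bar>e j\<bar>"
    using assms(2) unfolding dominant_with_coeff_def by blast
  \<comment> \<open>A collision needs a second index in the support of \<open>e\<close>; balance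
    supplies it because \<open>e j\<close> is nonzero.\<close>
  have "\<exists>i. i \<noteq> j \<and> e i \<noteq> 0"
  proof (rule ccontr)
    assume "\<not> ?thesis"
    then have "(\<Sum>i\<in>UNIV - {j}. e i) = 0" by (intro sum.neutral) auto
    then have "e j = 0"
      using bal unfolding balanced_eq_def by (simp add: sum.remove[of UNIV j])
    with dom show False by (simp add: dominant_at_def)
  qed
  then obtain i where i: "i \<noteq> j" "e i \<noteq> 0" by blast
  have False if x: "\<And>i. x i \<in> ?A" and "inj x" and sol: "is_solution p n (reduce_mod p S) x"
    for x :: "'r \<Rightarrow> nat \<Rightarrow> int"
  proof -
    have eq: "(\<Sum>i\<in>UNIV. e i * x i k) = 0" if "k < n" for k
    proof (rule dominant_eq_no_wraparound[OF bal dom])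
      show "0 \<le> x i k" "x i k \<le> int m" for i
        using x[of i] \<open>k < n\<close> by (auto simp: PiE_iff)
      show "\<bar>e j\<bar> * int m < int p" using assms(4) b by simp
      show "int p dvd (\<Sum>i\<in>UNIV. e i * x i k)"
        using sol \<open>e \<in> set S\<close> \<open>k < n\<close> is_solution_reduce_mod_iff[OF \<open>1 < p\<close>] by blast
    qed
    have "x i k = x j k" if "k \<in> {..<n}" for k
      using x eq i that
      by (intro dominant_on_sphere_coincide[OF bal dom, where K = "{..<n}" and r = r]) auto
    moreover have "x i \<in> {..<n} \<rightarrow>\<^sub>E {0..int m}" "x j \<in> {..<n} \<rightarrow>\<^sub>E {0..int m}"
      using x by auto
    \<comment> \<open>Agreement on \<open>{..<n}\<close> is equality since the vectors are
      extensional.\<close>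
    ultimately have "x i = x j" by (metis PiE_ext)
    with \<open>inj x\<close> i show False by (auto dest: injD)
  qed
  then show ?thesis unfolding weakly_free_def by blast
qed

lemma card_le_ex_sharp:
  fixes S :: "('r::finite) eqsystem"
  assumes "p > 0" "A \<subseteq> Fp_space p n" "weakly_free S p n A"
  shows "card A \<le> ex_sharp S n p"
  unfolding ex_sharp_def using ex_sharp_family(1)[OF assms(1)] assms(2,3) by (intro Max_ge) auto

theorem theorem5p4:
  fixes S :: "('r::finite) eqsystem" and b :: int
  assumes "balanced S"
    and "\<exists>e\<in>set S. dominant_with_coeff e b"
    and "b \<ge> 2"
  shows "\<forall>p::nat. prime p \<and> int p > b \<longrightarrow>
           (\<exists>n0::nat. \<forall>n\<ge>n0. real (ex_sharp S n p) \<ge> (real p / real_of_int b) ^ n)"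
proof (intro allI impI)
  fix p :: nat
  assume p: "prime p \<and> int p > b"
  obtain e where e: "e \<in> set S" "dominant_with_coeff e b" using assms(2) by blast
  define c where "c = nat b"
  \<comment> \<open>The largest \<open>m\<close> with \<open>c * m < p\<close>, that is, the largest
    cube on which the dominant equation cannot wrap around.\<close>
  define m where "m = (p - 1) div c"
  have c: "b = int c" "c \<ge> 2" "c < p" using assms(3) p by (auto simp: c_def)
  have cm: "c * m < p"
    using c times_div_less_eq_dividend[of c "p - 1"] unfolding m_def by linarith
  have "\<not> c dvd p"
    using p c by (auto simp: prime_nat_iff)
  \<comment> \<open>Division alone gives only this weak inequality; \<open>\<not> c dvd p\<close>
    makes it strict, which is what yields \<open>q > 1\<close>.\<close>
  moreover have "p \<le> c * (m + 1)"
    using dividend_less_times_div[of c "p - 1"] c unfolding m_def by (simp add: algebra_simps)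
  ultimately have "p < c * (m + 1)"
    by (cases "p = c * (m + 1)") auto
  then have "real p < real c * (real m + 1)"
    using of_nat_less_iff[of p "c * (m + 1)", where 'a = real] by (simp add: algebra_simps)
  define q where "q = (real m + 1) / (real p / real c)"
  have q: "q > 1"
    unfolding q_def using \<open>real p < _\<close> c by (simp add: field_simps)
  \<comment> \<open>The number of spheres is linear in \<open>n\<close>, so the exponential gain
    \<open>q ^ n\<close> of the cube over \<open>(p / c) ^ n\<close> eventually absorbs the
    pigeonhole loss; this fixes \<open>n0\<close>.\<close>
  have "eventually (\<lambda>n. real n * (real m)\<^sup>2 + 1 \<le> q ^ n) sequentially"
    using q by real_asymp
  then obtain n0 where n0: "\<And>n. n \<ge> n0 \<Longrightarrow> real n * (real m)\<^sup>2 + 1 \<le> q ^ n"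
    unfolding eventually_sequentially by blast
  have "(real p / real_of_int b) ^ n \<le> real (ex_sharp S n p)" if "n \<ge> n0" for n
  proof -
    obtain r :: int where
      r: "(m + 1) ^ n \<le> (n * m\<^sup>2 + 1) * card {v \<in> {..<n} \<rightarrow>\<^sub>E {0..int m}. (\<Sum>k<n. (v k)\<^sup>2) = r}"
      (is "_ \<le> _ * card ?A")
      using card_popular_sphere .
    have "1 * m \<le> c * m" using c by (intro mult_le_mono1) auto
    then have "m < p" using cm by linarith
    then have "{..<n} \<rightarrow>\<^sub>E {0..int m} \<subseteq> Fp_space p n"
      unfolding Fp_space_def Fp_def residue_ring_def by (intro PiE_mono) auto
    then have "?A \<subseteq> Fp_space p n" by blast
    moreover have "weakly_free S p n ?A"
      using e c cm by (intro sphere_weakly_free) (auto simp flip: of_nat_mult)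
    ultimately have "card ?A \<le> ex_sharp S n p"
      using c by (intro card_le_ex_sharp) auto
    then have "(m + 1) ^ n \<le> (n * m\<^sup>2 + 1) * ex_sharp S n p"
      using r mult_le_mono2 le_trans by blast
    then have "real ((m + 1) ^ n) \<le> real ((n * m\<^sup>2 + 1) * ex_sharp S n p)"
      by (rule of_nat_mono)
    then have "(real m + 1) ^ n \<le> (real n * (real m)\<^sup>2 + 1) * real (ex_sharp S n p)"
      by (simp add: algebra_simps)
    also have "\<dots> \<le> q ^ n * real (ex_sharp S n p)"
      using n0[OF that] by (intro mult_right_mono) auto
    \<comment> \<open>Here \<open>real m + 1\<close> is written as
      \<open>q * (real p / real c)\<close>, so that \<open>q ^ n\<close> cancels on both
      sides.\<close>
    finally have "(q * (real p / real c)) ^ n \<le> q ^ n * real (ex_sharp S n p)"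
      using c by (simp add: q_def)
    then show ?thesis
      using q c unfolding power_mult_distrib by simp
  qed
  then show "\<exists>n0. \<forall>n\<ge>n0. real (ex_sharp S n p) \<ge> (real p / real_of_int b) ^ n" by blast
qed

end
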